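(* Let $\alpha>1$, and let $0<\varepsilon<R$ and $\psi=(\psi_k)_{k\ge1}$ be a local solution family in the sense of the context. Set $\Omega=(-\varepsilon,\varepsilon)^2$, $W^{s}_{\mathrm{loc}}(0)=\{(u_0,\psi_1(u_0)):\ |u_0|<\varepsilon\}$, and $$\tilde\Omega=h(\Omega),\qquad \tilde W^{s}_{\mathrm{loc}}(0)=h(W^{s}_{\mathrm{loc}}(0)),\qquad h(u,w)=\bigl(P_\alpha(u+w),\ w-P_\alpha(u+w)\bigr).$$ Consider the recursion $(x_{n+1},z_{n+1})=T(x_n,z_n)$, where $$T(x,z)=\bigl(z,\ q(z)+2z-x\bigr),\qquad q(x)=P_{1/\alpha}(x)-4x.$$ Then: i) $\tilde W^{s}_{\mathrm{loc}}(0)$ is positively invariant by $T$, i.e. $T(\tilde W^{s}_{\mathrm{loc}}(0))\subset\tilde W^{s}_{\mathrm{loc}}(0)$. ii) If $(x_0,z_0)\in\tilde W^{s}_{\mathrm{loc}}(0)$, then the corresponding solution of the recursion satisfies $\lim_{n\to+\infty}(x_n,z_n)=0$. iii) Every solution of the recursion such that $(x_n,z_n)\in\tilde\Omega$ for all $n\ge0$ satisfies $(x_n,z_n)\in\tilde W^{s}_{\mathrm{loc}}(0)$ for all $n\ge0$. iv) There exist $\varepsilon_1>0$ and a function $\gamma\in C^1((-\varepsilon_1,\varepsilon_1),\mathbb{R})$ such that $$\tilde W^{s}_{\mathrm{loc}}(0)=\{(x,\gamma(x))\in\mathbb{R}^2:\ |x|<\varepsilon_1\}\subset\tilde\Omega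 .$$ The function $\gamma$ is odd, increasing and satisfies $\gamma(x)=P_\alpha(x)+o(|x|^\alpha)$ when $x\to0$.
   Context: For $\beta>0$, $P_\beta(x)=x|x|^{\beta-1}$ for $x\neq0$ and $P_\beta(0)=0$; thus $P_{1/\alpha}=P_\alpha^{-1}$. $\ell_\infty(\mathbb{N})$ is the space of bounded real sequences $(u_n)_{n\ge1}$ with the supremum norm, $B_\infty(R)$ its open ball of radius $R$ centered at $0$, and $B(\varepsilon)=(-\varepsilon,\varepsilon)$. The map $h$ is a homeomorphism of $\mathbb{R}^2$. For $u_0\in\mathbb{R}$ and $u\in\ell_\infty(\mathbb{N})$ define $g(u_0,u)\in\ell_\infty(\mathbb{N})$ by $(g(u_0,u))_n=u_n-P_\alpha(u_{n+1}+u_n)-P_\alpha(u_n+u_{n-1})$, $n\ge1$. A "local solution family" consists of $0<\varepsilon<R$ and an odd function $\psi=(\psi_k)_{k\ge1}\in C^1(B(\varepsilon),B_\infty(R))$ with the following properties (the paper proves beforehand that such $\varepsilon,R,\psi$ exist): (a) $g(u_0,\psi(u_0))=0$ for all $u_0\in B(\varepsilon)$, and every $(u_0,u)\in B(\varepsilon)\times B_\infty(R)$ with $g(u_0,u)=0$ satisfies $u=\psi(u_0)$; (b) $\psi_1$ is increasing, $|\psi_1(u_0)|<|u_0|$ for $u_0\in B(\varepsilon)\setminus\{0\}$, and $\psi_1(u_0)=P_\alpha(u_0)+O(|u_0|^{2\alpha-1})$ as $u_0\to0$; (c) $\psi_k$ is the $k$-fold composition of $\psi_1$, and $\psi_1=P_\alpha\circ(\mathrm{Id}+\psi_1)\circ\psi_1+P_\alpha\circ(\mathrm{Id}+\psi_1)$;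 (d) $\lim_{k\to+\infty}\psi_k(u_0)=0$ for all $u_0\in B(\varepsilon)$, and for all $C>1$ there is $\varepsilon_C\in(0,\varepsilon]$ such that $|\psi_k(u_0)|\le C^{\frac1{1-\alpha}}(C^{\frac1{\alpha-1}}|u_0|)^{\alpha^k}$ for all $u_0\in B(\varepsilon_C)$, $k\ge1$. *)

theory Defs
  imports "HOL-Analysis.Analysis" "HOL-Library.Landau_Symbols"
begin

definition spow :: "real \<Rightarrow> real \<Rightarrow> real" where
  "spow \<beta> x = (if x = 0 then 0 else x * \<bar>x\<bar> powr (\<beta> - 1))"

(* Since nat carries the discrete topology, nat \<Rightarrow>\<^sub>C real is the space of all bounded real
   sequences with the supremum norm.  Sequences (u_n) with n >= 1 are stored shifted by one:
   u_n is the value at n - 1, so coord u n is only meaningful for n >= 1. *)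
type_synonym linf = "nat \<Rightarrow>\<^sub>C real"

definition coord :: "linf \<Rightarrow> nat \<Rightarrow> real" where
  "coord u n = apply_bcontfun u (n - 1)"

definition prepend :: "real \<Rightarrow> linf \<Rightarrow> nat \<Rightarrow> real" where
  "prepend u0 u n = (if n = 0 then u0 else coord u n)"

(* The abstraction Bcontfun is applied to a bounded sequence only if \<alpha> >= 0;
   coord_stationary_map confirms the intended coordinates for \<alpha> > 0. *)
definition stationary_map :: "real \<Rightarrow> real \<Rightarrow> linf \<Rightarrow> linf" where
  "stationary_map \<alpha> u0 u = Bcontfun (\<lambda>m.
     let v = prepend u0 u; n = Suc m in
       v n - spow \<alpha> (v (n + 1) + v n) - spow \<alpha> (v n + v (n - 1)))"

lemma abs_spow: "\<beta> > 0 \<Longrightarrow> \<bar>spow \<beta> x\<bar> = \<bar>x\<bar> powr \<beta>"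
  by (auto simp: spow_def abs_mult powr_diff)

lemma abs_prepend_le: "\<bar>prepend u0 u n\<bar> \<le> \<bar>u0\<bar> + norm u"
  using norm_bounded[of u "n - 1"] by (auto simp: prepend_def coord_def)

lemma coord_stationary_map:
  assumes "\<alpha> > 0" "n \<ge> 1"
  shows "coord (stationary_map \<alpha> u0 u) n =
    prepend u0 u n - spow \<alpha> (prepend u0 u (n + 1) + prepend u0 u n)
                   - spow \<alpha> (prepend u0 u n + prepend u0 u (n - 1))"
proof -
  define K where "K = \<bar>u0\<bar> + norm u"
  define f where "f m = (let v = prepend u0 u; n = Suc m in
       v n - spow \<alpha> (v (n + 1) + v n) - spow \<alpha> (v n + v (n - 1)))" for m
  have v: "\<bar>prepend u0 u i\<bar> \<le> K" for i
    unfolding K_def by (rule abs_prepend_le)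
  have s: "\<bar>spow \<alpha> (prepend u0 u i + prepend u0 u j)\<bar> \<le> (2 * K) powr \<alpha>" for i j
    unfolding abs_spow[OF assms(1)]
    using v[of i] v[of j] assms(1) by (intro powr_mono2) auto
  have "\<bar>f m\<bar> \<le> K + (2 * K) powr \<alpha> + (2 * K) powr \<alpha>" for m
    using v[of "Suc m"] s[of "Suc m + 1" "Suc m"] s[of "Suc m" "Suc m - 1"]
    unfolding f_def Let_def by linarith
  then have "f \<in> bcontfun"
    by (intro bcontfun_normI[where b = "K + (2 * K) powr \<alpha> + (2 * K) powr \<alpha>"]) auto
  then have "apply_bcontfun (Bcontfun f) = f"
    by (rule Bcontfun_inverse)
  then show ?thesis
    using assms(2) by (simp add: stationary_map_def coord_def f_def[abs_def] Let_def)
qed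

definition local_solution_family ::
    "real \<Rightarrow> real \<Rightarrow> real \<Rightarrow> (real \<Rightarrow> linf) \<Rightarrow> bool" where
  "local_solution_family \<alpha> \<epsilon> R \<psi> \<longleftrightarrow>
     (let B = {-\<epsilon><..<\<epsilon>}; \<psi>1 = (\<lambda>u. coord (\<psi> u) 1) in
      0 < \<epsilon> \<and> \<epsilon> < R \<and>
      \<psi> C1_differentiable_on B \<and> \<psi> ` B \<subseteq> ball 0 R \<and>
      (\<forall>u0\<in>B. \<psi> (- u0) = - \<psi> u0) \<and>
      (\<forall>u0\<in>B. stationary_map \<alpha> u0 (\<psi> u0) = 0) \<and>
      (\<forall>u0\<in>B. \<forall>u\<in>ball 0 R. stationary_map \<alpha> u0 u = 0 \<longrightarrow> u = \<psi> u0) \<and>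
      strict_mono_on B \<psi>1 \<and>
      (\<forall>u0\<in>B - {0}. \<bar>\<psi>1 u0\<bar> < \<bar>u0\<bar>) \<and>
      (\<lambda>u0. \<psi>1 u0 - spow \<alpha> u0) \<in> O[at 0](\<lambda>u0. \<bar>u0\<bar> powr (2 * \<alpha> - 1)) \<and>
      (\<forall>k\<ge>1. \<forall>u0\<in>B. coord (\<psi> u0) k = (\<psi>1 ^^ k) u0) \<and>
      (\<forall>u0\<in>B. \<psi>1 u0 = spow \<alpha> (\<psi>1 u0 + \<psi>1 (\<psi>1 u0)) + spow \<alpha> (u0 + \<psi>1 u0)) \<and>
      (\<forall>u0\<in>B. (\<lambda>k. coord (\<psi> u0) k) \<longlonglongrightarrow> 0) \<and>
      (\<forall>C>1. \<exists>\<epsilon>C. 0 < \<epsilon>C \<and> \<epsilon>C \<le> \<epsilon> \<and>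
         (\<forall>u0\<in>{-\<epsilon>C<..<\<epsilon>C}. \<forall>k\<ge>1.
            \<bar>coord (\<psi> u0) k\<bar>
              \<le> C powr (1 / (1 - \<alpha>)) * (C powr (1 / (\<alpha> - 1)) * \<bar>u0\<bar>) powr (\<alpha> ^ k))))"

definition h_map :: "real \<Rightarrow> real \<times> real \<Rightarrow> real \<times> real" where
  "h_map \<alpha> = (\<lambda>(u, w). (spow \<alpha> (u + w), w - spow \<alpha> (u + w)))"

definition q_map :: "real \<Rightarrow> real \<Rightarrow> real" where
  "q_map \<alpha> x = spow (1 / \<alpha>) x - 4 * x"

definition T_map :: "real \<Rightarrow> real \<times> real \<Rightarrow> real \<times> real" where
  "T_map \<alpha> = (\<lambda>(x, z). (z, q_map \<alpha> z + 2 * z - x))"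

definition T_solution :: "real \<Rightarrow> (nat \<Rightarrow> real \<times> real) \<Rightarrow> bool" where
  "T_solution \<alpha> s \<longleftrightarrow> (\<forall>n. s (Suc n) = T_map \<alpha> (s n))"

definition Omega :: "real \<Rightarrow> (real \<times> real) set" where
  "Omega \<epsilon> = {-\<epsilon><..<\<epsilon>} \<times> {-\<epsilon><..<\<epsilon>}"

definition Ws_loc :: "real \<Rightarrow> (real \<Rightarrow> linf) \<Rightarrow> (real \<times> real) set" where
  "Ws_loc \<epsilon> \<psi> = {(u0, coord (\<psi> u0) 1) | u0. \<bar>u0\<bar> < \<epsilon>}"

definition Omega_tilde :: "real \<Rightarrow> real \<Rightarrow> (real \<times> real) set" where
  "Omega_tilde \<alpha> \<epsilon> = h_map \<alpha> ` Omega \<epsilon>"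

definition Ws_loc_tilde :: "real \<Rightarrow> real \<Rightarrow> (real \<Rightarrow> linf) \<Rightarrow> (real \<times> real) set" where
  "Ws_loc_tilde \<alpha> \<epsilon> \<psi> = h_map \<alpha> ` Ws_loc \<epsilon> \<psi>"

end

theory Submission
  imports Defs
begin

text \<open>Write \<open>\<phi> = \<psi>\<^sub>1\<close> and \<open>G u = P (u + \<phi> u)\<close> with \<open>P = spow \<alpha>\<close>. The functional equation of \<open>\<phi>\<close> reads
  \<open>\<phi> = G \<circ> \<phi> + G\<close>, so \<open>h (u, \<phi> u) = (G u, G (\<phi> u))\<close>: on the stable curve \<open>T\<close> acts as \<open>u \<mapsto> \<phi> u\<close>.
  An orbit of \<open>T\<close> staying in \<open>h \<Omega>\<close> has the form \<open>h (u\<^sub>n, u\<^sub>n\<^sub>+\<^sub>1)\<close> with \<open>u\<close> a small solution of the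
  stationary equation, and uniqueness gives \<open>u\<^sub>1 = \<phi> u\<^sub>0\<close>.
  As \<open>G\<close> is odd and increasing, the curve is the graph of \<open>\<gamma> = G \<circ> \<phi> \<circ> V\<close> with \<open>V\<close> the inverse of
  \<open>G\<close>. The function \<open>V\<close> is not differentiable at \<open>0\<close>, but \<open>\<bar>\<phi> (V x)\<bar> \<le> 2 * \<bar>x\<bar>\<close> makes the derivative
  of \<open>\<gamma>\<close> of order \<open>\<bar>x\<bar> powr ((\<alpha> - 1)\<^sup>2 / \<alpha>)\<close> there.\<close>

section \<open>Signed powers\<close>

lemma spow_0 [simp]: "spow \<beta> 0 = 0"
  by (simp add: spow_def)

lemma spow_1 [simp]: "spow \<beta> 1 = 1"
  by (simp add: spow_def)

lemma spow_minus [simp]: "spow \<beta> (- x) = - spow \<beta> x"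
  by (simp add: spow_def)

lemma spow_mult: "spow \<beta> (x * y) = spow \<beta> x * spow \<beta> y"
  by (simp add: spow_def abs_mult powr_mult)

lemma spow_of_nonneg: "x \<ge> 0 \<Longrightarrow> spow \<beta> x = x powr \<beta>"
  by (auto simp: spow_def powr_diff)

lemma sgn_spow [simp]: "sgn (spow \<beta> x) = sgn x"
  by (auto simp: spow_def sgn_mult)

lemma spow_eq_sgn_powr: "spow \<beta> x = sgn x * \<bar>x\<bar> powr \<beta>"
  by (auto simp: spow_def sgn_if powr_diff)

lemma spow_spow:
  assumes "\<beta> > 0"
  shows "spow \<beta>' (spow \<beta> x) = spow (\<beta> * \<beta>') x"
  using assms
  by (simp add: spow_eq_sgn_powr[of \<beta>'] abs_spow powr_powr) (simp add: spow_eq_sgn_powr)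

lemma spow_inverse:
  assumes "\<beta> > 0"
  shows "spow (1 / \<beta>) (spow \<beta> x) = x" "spow \<beta> (spow (1 / \<beta>) x) = x"
  using assms by (simp_all add: spow_spow) (simp_all add: spow_def)

lemma spow_strict_mono:
  assumes "\<beta> > 0" "x < y"
  shows "spow \<beta> x < spow \<beta> y"
proof -
  consider "x \<ge> 0" | "x < 0" "y > 0" | "y \<le> 0" "x < 0"
    using assms(2) by linarith
  then show ?thesis
  proof cases
    case 1
    then show ?thesis
      using assms by (simp add: spow_of_nonneg powr_less_mono2)
  next
    case 2
    then have "sgn (spow \<beta> x) = -1" "sgn (spow \<beta> y) = 1"
      by simp_all
    then show ?thesis
      by (auto simp: sgn_if split: if_splits)
  next
    case 3
    have "spow \<beta> (- y) < spow \<beta> (- x)"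
      using assms 3 by (subst (1 2) spow_of_nonneg) (auto intro!: powr_less_mono2)
    then show ?thesis
      by simp
  qed
qed

text \<open>For positive arguments this is the ordinary power rule, and oddness carries it to
  negative ones. At 0 the difference quotient is \<open>\<bar>h\<bar> powr (\<beta> - 1)\<close>,
  which tends to 0 because \<beta> > 1.\<close>

lemma has_real_derivative_spow:
  assumes "\<beta> > 1"
  shows "(spow \<beta> has_real_derivative \<beta> * \<bar>x\<bar> powr (\<beta> - 1)) (at x)"
proof -
  have pos: "(spow \<beta> has_real_derivative \<beta> * x powr (\<beta> - 1)) (at x)" if "x > 0" for x :: real
  proof (rule has_field_derivative_transform_within_open[where S = "{0<..}"])
    show "((\<lambda>x. x powr \<beta>) has_real_derivative \<beta> * x powr (\<beta> - 1)) (at x)"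
      using that by (auto intro!: derivative_eq_intros)
  qed (use that in \<open>auto simp: spow_of_nonneg\<close>)
  consider "x > 0" | "x < 0" | "x = 0" by linarith
  then show ?thesis
  proof cases
    case 1
    then show ?thesis using pos by simp
  next
    case 2
    have "((\<lambda>y. - spow \<beta> (- y)) has_real_derivative - (\<beta> * (- x) powr (\<beta> - 1) * (- 1))) (at x)"
      by (rule DERIV_minus[OF DERIV_chain2[OF pos DERIV_minus[OF DERIV_ident]]]) (use 2 in simp)
    then show ?thesis using 2 by simp
  next
    case 3
    have "((\<lambda>h::real. \<bar>h\<bar> powr (\<beta> - 1)) \<longlongrightarrow> 0) (at 0)"
      using assms by (auto intro!: tendsto_eq_intros)
    moreover have "\<forall>\<^sub>F h in at 0. \<bar>h\<bar> powr (\<beta> - 1) = (spow \<beta> (0 + h) - spow \<beta> 0) / h"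
      by (auto simp: eventually_at_filter spow_def)
    ultimately show ?thesis
      using assms 3 unfolding DERIV_def by (auto intro: Lim_transform_eventually)
  qed
qed

lemma isCont_spow: "\<beta> > 1 \<Longrightarrow> isCont (spow \<beta>) x"
  using has_real_derivative_spow DERIV_isCont by blast

section \<open>The stationary equation in coordinates\<close>

lemma stationary_map_eq_0_iff:
  assumes "\<alpha> > 0"
  shows "stationary_map \<alpha> u0 u = 0 \<longleftrightarrow>
    (\<forall>n\<ge>1. prepend u0 u n = spow \<alpha> (prepend u0 u (n + 1) + prepend u0 u n)
                   + spow \<alpha> (prepend u0 u n + prepend u0 u (n - 1)))"
proof -
  have "stationary_map \<alpha> u0 u = 0 \<longleftrightarrow> (\<forall>n\<ge>1. coord (stationary_map \<alpha> u0 u) n = 0)"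
  proof
    assume R: "\<forall>n\<ge>1. coord (stationary_map \<alpha> u0 u) n = 0"
    show "stationary_map \<alpha> u0 u = 0"
    proof (rule bcontfun_eqI)
      fix m show "apply_bcontfun (stationary_map \<alpha> u0 u) m = apply_bcontfun 0 m"
        using R[rule_format, of "Suc m"] by (simp add: coord_def)
    qed
  qed (simp add: coord_def)
  then show ?thesis
    using assms by (auto simp: coord_stationary_map algebra_simps)
qed

text \<open>Packages a bounded orbit as an element of \<open>linf\<close>, so that uniqueness of
  solutions of the stationary equation can be applied to it.\<close>

lemma ex_linf_coord:
  assumes "\<And>n. \<bar>f n\<bar> \<le> K"
  obtains u :: linf where "\<And>n. n \<ge> 1 \<Longrightarrow> coord u n = f n" "norm u \<le> K"
proof -
  have "(\<lambda>m. f (Suc m)) \<in> bcontfun"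
    using assms by (intro bcontfun_normI[where b = K]) auto
  then have u: "apply_bcontfun (Bcontfun (\<lambda>m. f (Suc m))) = (\<lambda>m. f (Suc m))"
    by (rule Bcontfun_inverse)
  show thesis
  proof (rule that)
    show "norm (Bcontfun (\<lambda>m. f (Suc m))) \<le> K"
      using assms by (intro norm_bound) (simp add: u)
  qed (simp add: coord_def u)
qed

text \<open>Carries the derivative of \<psi> and its continuity from \<open>linf\<close> over to the
  scalar function \<phi>.\<close>

lemma bounded_linear_coord: "bounded_linear (\<lambda>u. coord u n)"
  by (rule bounded_linear_intro[where K = 1])
     (auto simp: coord_def norm_bounded[where 'b = real, simplified])

section \<open>The stable curve as a graph\<close>

text \<open>Isolates the scalar properties of the first coordinate from which the graph is built.
  The contraction is stated with \<le> so that it includes u = 0, where it yields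
  \<open>\<phi> 0 = 0\<close>.\<close>

locale stable_curve =
  fixes \<alpha> \<epsilon> :: real and \<phi> \<phi>' :: "real \<Rightarrow> real"
  assumes \<alpha>: "\<alpha> > 1" and \<epsilon>: "\<epsilon> > 0"
    and odd: "\<bar>u\<bar> < \<epsilon> \<Longrightarrow> \<phi> (- u) = - \<phi> u"
    and mono: "strict_mono_on {-\<epsilon><..<\<epsilon>} \<phi>"
    and contracting: "\<bar>u\<bar> < \<epsilon> \<Longrightarrow> \<bar>\<phi> u\<bar> \<le> \<bar>u\<bar>"
    and invariance: "\<bar>u\<bar> < \<epsilon> \<Longrightarrow>
      \<phi> u = spow \<alpha> (\<phi> u + \<phi> (\<phi> u)) + spow \<alpha> (u + \<phi> u)"
    and deriv: "\<bar>u\<bar> < \<epsilon> \<Longrightarrow> (\<phi> has_real_derivative \<phi>' u) (at u)"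
    and deriv_cont: "\<bar>u\<bar> < \<epsilon> \<Longrightarrow> isCont \<phi>' u"
begin

definition G :: "real \<Rightarrow> real" where
  "G u = spow \<alpha> (u + \<phi> u)"

definition G' :: "real \<Rightarrow> real" where
  "G' u = \<alpha> * \<bar>u + \<phi> u\<bar> powr (\<alpha> - 1) * (1 + \<phi>' u)"

text \<open>G maps the interval of radius \<epsilon> onto the open interval of radius \<delta>, so
  this is the radius on which the graph lives.\<close>

definition \<delta> :: real where
  "\<delta> = Sup (G ` {-\<epsilon><..<\<epsilon>})"

definition V :: "real \<Rightarrow> real" where
  "V = the_inv_into {-\<epsilon><..<\<epsilon>} G"

definition \<gamma> :: "real \<Rightarrow> real" where
  "\<gamma> x = G (\<phi> (V x))"

text \<open>At \<open>x = 0\<close> this is \<open>0 / 0 = 0\<close>, which is the correct value.\<close>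

definition \<gamma>' :: "real \<Rightarrow> real" where
  "\<gamma>' x = G' (\<phi> (V x)) * \<phi>' (V x) / G' (V x)"

section \<open>Elementary properties of \<phi>\<close>

lemma \<phi>_bound: "\<bar>u\<bar> < \<epsilon> \<Longrightarrow> \<bar>\<phi> u\<bar> < \<epsilon>"
  using contracting[of u] by linarith

lemma \<phi>_0: "\<phi> 0 = 0"
  using contracting[of 0] \<epsilon> by simp

lemma \<phi>_less: "\<bar>u\<bar> < \<epsilon> \<Longrightarrow> \<bar>v\<bar> < \<epsilon> \<Longrightarrow> u < v \<Longrightarrow> \<phi> u < \<phi> v"
  using mono by (auto simp: strict_mono_on_def abs_less_iff)

text \<open>A negative derivative would make \<phi> drop immediately to the right of u, against
  monotonicity.\<close>

lemma \<phi>'_nonneg: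
  assumes "\<bar>u\<bar> < \<epsilon>"
  shows "\<phi>' u \<ge> 0"
proof (rule ccontr)
  assume "\<not> \<phi>' u \<ge> 0"
  then obtain d where d: "d > 0" "\<And>h. 0 < h \<Longrightarrow> h < d \<Longrightarrow> \<phi> (u + h) < \<phi> u"
    using DERIV_neg_dec_right[OF deriv[OF assms]] by auto
  obtain h where "0 < h" "h < min d (\<epsilon> - u)"
    using dense[of 0 "min d (\<epsilon> - u)"] d(1) assms by (auto simp: abs_less_iff)
  then show False
    using d(2)[of h] \<phi>_less[of u "u + h"] assms by (auto simp: abs_less_iff)
qed

section \<open>The map G: dynamics on the curve, monotonicity and derivative\<close>

lemma G_split: "\<bar>u\<bar> < \<epsilon> \<Longrightarrow> \<phi> u = G (\<phi> u) + G u"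
  using invariance by (simp add: G_def)

lemma h_map_curve: "\<bar>u\<bar> < \<epsilon> \<Longrightarrow> h_map \<alpha> (u, \<phi> u) = (G u, G (\<phi> u))"
  using G_split[of u] by (simp add: h_map_def G_def)

text \<open>Inverting the power in \<open>G (\<phi> u)\<close> gives
  \<open>\<phi> u + \<phi> (\<phi> u)\<close>. Once \<open>G_split\<close> is applied to both terms,
  \<open>- 2 * z - x\<close> cancels everything except \<open>G (\<phi> (\<phi> u))\<close>.\<close>

lemma T_map_curve:
  assumes "\<bar>u\<bar> < \<epsilon>"
  shows "T_map \<alpha> (G u, G (\<phi> u)) = (G (\<phi> u), G (\<phi> (\<phi> u)))"
proof -
  have "spow (1 / \<alpha>) (G (\<phi> u)) = \<phi> u + \<phi> (\<phi> u)"
    using \<alpha> by (simp add: G_def spow_inverse)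
  then show ?thesis
    using G_split[OF assms] G_split[OF \<phi>_bound[OF assms]] by (simp add: T_map_def q_map_def)
qed

lemma G_0: "G 0 = 0"
  by (simp add: G_def \<phi>_0)

lemma G_minus: "\<bar>u\<bar> < \<epsilon> \<Longrightarrow> G (- u) = - G u"
  using spow_minus[of \<alpha> "u + \<phi> u"] by (simp add: G_def odd)

lemma G_less: "\<bar>u\<bar> < \<epsilon> \<Longrightarrow> \<bar>v\<bar> < \<epsilon> \<Longrightarrow> u < v \<Longrightarrow> G u < G v"
  using \<phi>_less[of u v] \<alpha> by (auto simp: G_def intro: spow_strict_mono)

lemma G_le_iff: "\<bar>u\<bar> < \<epsilon> \<Longrightarrow> \<bar>v\<bar> < \<epsilon> \<Longrightarrow> G u \<le> G v \<longleftrightarrow> u \<le> v"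
  using G_less[of u v] G_less[of v u] by (cases u v rule: linorder_cases) auto

lemma abs_G_mono:
  assumes "\<bar>u\<bar> < \<epsilon>" "\<bar>v\<bar> \<le> \<bar>u\<bar>"
  shows "\<bar>G v\<bar> \<le> \<bar>G u\<bar>"
proof -
  \<comment> \<open>G is odd and has the sign of its argument, so comparing absolute values reduces
    to monotonicity on nonnegative arguments.\<close>
  have "\<bar>G w\<bar> = G \<bar>w\<bar>" if "\<bar>w\<bar> < \<epsilon>" for w
    using that G_minus[of w] G_le_iff[of 0 w] G_le_iff[of w 0] \<epsilon> by (auto simp: G_0 abs_if)
  then show ?thesis
    using assms by (simp add: G_le_iff)
qed

lemma G_deriv: "\<bar>u\<bar> < \<epsilon> \<Longrightarrow> (G has_real_derivative G' u) (at u)"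
  unfolding G_def[abs_def] G'_def using \<alpha>
  by (intro DERIV_chain2[OF has_real_derivative_spow]) (auto intro!: derivative_eq_intros deriv)

lemma isCont_\<phi>: "\<bar>u\<bar> < \<epsilon> \<Longrightarrow> isCont \<phi> u"
  using deriv DERIV_isCont by blast

lemma isCont_G: "\<bar>u\<bar> < \<epsilon> \<Longrightarrow> isCont G u"
  using G_deriv DERIV_isCont by blast

lemma isCont_G': "\<bar>u\<bar> < \<epsilon> \<Longrightarrow> isCont G' u"
  unfolding G'_def[abs_def] using \<alpha> deriv_cont[of u] isCont_\<phi>[of u]
  by (auto intro!: continuous_intros simp: isCont_def intro!: tendsto_eq_intros)

text \<open>If \<open>G u\<close> is nonzero then so is \<open>u + \<phi> u\<close>, and the factor
  \<open>1 + \<phi>' u\<close> is at least 1.\<close>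

lemma G'_pos: "\<bar>u\<bar> < \<epsilon> \<Longrightarrow> G u \<noteq> 0 \<Longrightarrow> G' u > 0"
  unfolding G_def G'_def using \<alpha> \<phi>'_nonneg[of u] by (auto intro!: mult_pos_pos)

section \<open>The range of G and its inverse V\<close>

text \<open>The supremum is not attained: G increases strictly on an open interval, so any value is
  exceeded further to the right. Oddness gives the lower bound.\<close>

lemma abs_G_less_\<delta>:
  assumes "\<bar>u\<bar> < \<epsilon>"
  shows "\<bar>G u\<bar> < \<delta>"
proof -
  have bdd: "bdd_above (G ` {-\<epsilon><..<\<epsilon>})"
  proof (rule bdd_aboveI2)
    fix u assume "u \<in> {-\<epsilon><..<\<epsilon>}"
    then have u: "\<bar>u\<bar> < \<epsilon>" by auto
    have "\<bar>G u\<bar> \<le> (2 * \<epsilon>) powr \<alpha>"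
      using u \<phi>_bound[OF u] \<alpha> by (auto simp: G_def abs_spow intro!: powr_mono2)
    then show "G u \<le> (2 * \<epsilon>) powr \<alpha>"
      by simp
  qed
  have *: "G v < \<delta>" if v: "\<bar>v\<bar> < \<epsilon>" for v
  proof -
    obtain w where w: "v < w" "w < \<epsilon>"
      using v dense[of v \<epsilon>] by (auto simp: abs_less_iff)
    have "G v < G w"
      using v w by (intro G_less) auto
    also have "\<dots> \<le> \<delta>"
      unfolding \<delta>_def using v w by (intro cSUP_upper bdd) auto
    finally show ?thesis .
  qed
  show ?thesis
    using *[OF assms] *[of "- u"] assms by (simp add: G_minus)
qed

lemma \<delta>_pos: "\<delta> > 0"
  using abs_G_less_\<delta>[of 0] \<epsilon> by (simp add: G_0)

lemma G_surj:
  assumes "\<bar>x\<bar> < \<delta>"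
  obtains u where "\<bar>u\<bar> < \<epsilon>" "G u = x"
proof -
  obtain b where b: "\<bar>b\<bar> < \<epsilon>" "\<bar>x\<bar> < G b"
    using less_cSupD[of "G ` {-\<epsilon><..<\<epsilon>}" "\<bar>x\<bar>"] assms \<epsilon> by (force simp: \<delta>_def)
  have "0 \<le> b"
    using b G_le_iff[of b 0] \<epsilon> by (force simp: G_0)
  \<comment> \<open>By oddness \<open>G (- b) = - G b\<close>, so x lies between the values of G at
    the two end points.\<close>
  have "\<exists>u. - b \<le> u \<and> u \<le> b \<and> G u = x"
    using b \<open>0 \<le> b\<close> by (intro IVT) (auto simp: G_minus intro!: isCont_G)
  then show thesis
    using that b by force
qed

lemma inj_on_G: "inj_on G {-\<epsilon><..<\<epsilon>}"
proof (rule linorder_inj_onI')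
  fix u v assume "u \<in> {-\<epsilon><..<\<epsilon>}" "v \<in> {-\<epsilon><..<\<epsilon>}" "u < v"
  then show "G u \<noteq> G v"
    using G_less[of u v] by (auto simp: abs_less_iff)
qed

lemma V_G: "\<bar>u\<bar> < \<epsilon> \<Longrightarrow> V (G u) = u"
  unfolding V_def by (intro the_inv_into_f_f inj_on_G) auto

lemma
  assumes "\<bar>x\<bar> < \<delta>"
  shows V_bound: "\<bar>V x\<bar> < \<epsilon>" and G_V: "G (V x) = x"
  using G_surj[OF assms] V_G by metis+

lemma V_0: "V 0 = 0"
  using V_G[of 0] \<epsilon> by (simp add: G_0)

lemma V_minus: "\<bar>x\<bar> < \<delta> \<Longrightarrow> V (- x) = - V x"
  using V_G[of "- V x"] by (simp add: G_minus V_bound G_V)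

lemma V_less: "\<bar>x\<bar> < \<delta> \<Longrightarrow> \<bar>y\<bar> < \<delta> \<Longrightarrow> x < y \<Longrightarrow> V x < V y"
  using G_le_iff[of "V y" "V x"] by (auto simp: V_bound G_V not_le)

lemma isCont_V:
  assumes "\<bar>x\<bar> < \<delta>"
  shows "isCont V x"
proof -
  have v: "\<bar>V x\<bar> < \<epsilon>" using assms by (rule V_bound)
  obtain a where a: "- \<epsilon> < a" "a < V x" using v dense[of "- \<epsilon>" "V x"] by (auto simp: abs_less_iff)
  obtain b where b: "V x < b" "b < \<epsilon>" using v dense[of "V x" \<epsilon>] by (auto simp: abs_less_iff)
  have "isCont V (G (V x))"
  proof (rule isCont_inverse_function2[where f = G])
    fix z assume "a \<le> z" "z \<le> b"
    with a b have "\<bar>z\<bar> < \<epsilon>" by linarith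
    then show "V (G z) = z" "isCont G z"
      by (rule V_G, rule isCont_G)
  qed (use a b in simp_all)
  then show ?thesis
    using assms by (simp add: G_V)
qed

text \<open>The origin is excluded because \<open>G' 0 = 0\<close>, so the inverse function rule
  fails there.\<close>

lemma V_deriv:
  assumes "\<bar>x\<bar> < \<delta>" "x \<noteq> 0"
  shows "(V has_real_derivative inverse (G' (V x))) (at x)"
proof (rule DERIV_inverse_function)
  show "(G has_real_derivative G' (V x)) (at (V x))"
    using assms by (intro G_deriv V_bound)
  show "G' (V x) \<noteq> 0"
    using G'_pos[of "V x"] assms by (simp add: V_bound G_V)
  show "- \<delta> < x" "x < \<delta>" using assms by auto
  show "G (V y) = y" if "- \<delta> < y" "y < \<delta>" for y
    using that by (intro G_V) auto
  show "isCont V x"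
    using assms by (intro isCont_V)
qed

section \<open>The graph function \<gamma>: bounds, regularity and leading term\<close>

text \<open>This is \<open>G_split\<close> at \<open>V x\<close>. It shows that the composition of
  \<phi> with V is comparable to x, although V itself grows like a root near 0.\<close>

lemma \<gamma>_eq: "\<bar>x\<bar> < \<delta> \<Longrightarrow> \<phi> (V x) = x + \<gamma> x"
  using G_split[of "V x"] by (simp add: \<gamma>_def V_bound G_V)

lemma \<phi>_V_bound: "\<bar>x\<bar> < \<delta> \<Longrightarrow> \<bar>\<phi> (V x)\<bar> < \<epsilon>"
  by (intro \<phi>_bound V_bound)

lemma abs_\<gamma>_le:
  assumes "\<bar>x\<bar> < \<delta>"
  shows "\<bar>\<gamma> x\<bar> \<le> \<bar>x\<bar>"
  using abs_G_mono[of "V x" "\<phi> (V x)"] assms by (simp add: \<gamma>_def V_bound contracting G_V)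

text \<open>\<open>\<phi> (V x) = x + \<gamma> x\<close> is at most \<open>2 * \<bar>x\<bar>\<close>
  in absolute value, and contraction bounds the second term by the first. The value
  \<open>\<gamma> x\<close> is the signed power of this sum.\<close>

lemma abs_sum_\<phi>_V_le:
  assumes "\<bar>x\<bar> < \<delta>"
  shows "\<bar>\<phi> (V x) + \<phi> (\<phi> (V x))\<bar> \<le> 4 * \<bar>x\<bar>"
  using \<gamma>_eq[OF assms] abs_\<gamma>_le[OF assms] contracting[OF \<phi>_V_bound[OF assms]] by linarith

lemma abs_\<gamma>_le_powr:
  assumes "\<bar>x\<bar> < \<delta>"
  shows "\<bar>\<gamma> x\<bar> \<le> (4 * \<bar>x\<bar>) powr \<alpha>"
  using abs_sum_\<phi>_V_le[OF assms] \<alpha> by (auto simp: \<gamma>_def G_def abs_spow intro!: powr_mono2)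

lemma \<gamma>_minus: "\<bar>x\<bar> < \<delta> \<Longrightarrow> \<gamma> (- x) = - \<gamma> x"
  by (simp add: \<gamma>_def V_minus odd V_bound G_minus \<phi>_V_bound)

lemma strict_mono_\<gamma>: "strict_mono_on {-\<delta><..<\<delta>} \<gamma>"
  by (auto simp: strict_mono_on_def \<gamma>_def
      intro!: G_less \<phi>_less V_less V_bound \<phi>_V_bound)

text \<open>Away from 0 this is the chain rule. At 0 the bound of order
  \<open>\<bar>x\<bar> powr \<alpha>\<close> forces the difference quotient to vanish in the
  limit.\<close>

lemma \<gamma>_deriv:
  assumes "\<bar>x\<bar> < \<delta>"
  shows "(\<gamma> has_real_derivative \<gamma>' x) (at x)"
proof (cases "x = 0")
  case False
  have "((\<lambda>x. G (\<phi> (V x))) has_real_derivative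
      G' (\<phi> (V x)) * (\<phi>' (V x) * inverse (G' (V x)))) (at x)"
    using assms False
    by (intro DERIV_chain2[where f = G] DERIV_chain2[where f = \<phi>] G_deriv deriv V_deriv
        V_bound \<phi>_V_bound)
  then show ?thesis
    by (simp add: \<gamma>_def[abs_def] \<gamma>'_def field_simps)
next
  case True
  have "((\<lambda>h. 4 powr \<alpha> * \<bar>h\<bar> powr (\<alpha> - 1)) \<longlongrightarrow> 0) (at (0::real))"
    using \<alpha> by (auto intro!: tendsto_eq_intros)
  moreover have "\<forall>\<^sub>F h in at 0. norm (\<gamma> h / h) \<le> 4 powr \<alpha> * \<bar>h\<bar> powr (\<alpha> - 1)"
    using eventually_at_in_open[of "{-\<delta><..<\<delta>}" 0]
  proof (rule eventually_mono)
    show "norm (\<gamma> h / h) \<le> 4 powr \<alpha> * \<bar>h\<bar> powr (\<alpha> - 1)" if "h \<in> {-\<delta><..<\<delta>} - {0}" for h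
      using that abs_\<gamma>_le_powr[of h]
      by (auto simp: abs_divide powr_mult powr_diff field_simps abs_less_iff)
  qed (use \<delta>_pos in auto)
  ultimately have "((\<lambda>h. \<gamma> h / h) \<longlongrightarrow> 0) (at 0)"
    by (rule Lim_null_comparison[rotated])
  then have "(\<gamma> has_real_derivative 0) (at 0)"
    by (simp add: DERIV_def \<gamma>_def V_0 \<phi>_0 G_0)
  then show ?thesis
    by (simp add: True \<gamma>'_def V_0 \<phi>_0 G'_def)
qed

text \<open>The numerator has order \<open>\<bar>x\<bar> powr (\<alpha> - 1)\<close> and the
  denominator \<open>\<bar>x\<bar> powr ((\<alpha> - 1) / \<alpha>)\<close>. The exponent in the
  bound is the difference of the two; it is positive, which makes \<open>\<gamma>'\<close> vanish
  continuously at 0.\<close>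

lemma abs_\<gamma>'_le:
  assumes "\<bar>x\<bar> < \<delta>"
  shows "\<bar>\<gamma>' x\<bar> \<le> 4 powr (\<alpha> - 1) * (1 + \<phi>' (\<phi> (V x))) * \<bar>x\<bar> powr ((\<alpha> - 1)\<^sup>2 / \<alpha>)"
proof (cases "x = 0")
  case True
  then show ?thesis
    by (simp add: \<gamma>'_def V_0 \<phi>_0 G'_def)
next
  case False
  define p where "p = \<phi>' (V x)"
  define p2 where "p2 = \<phi>' (\<phi> (V x))"
  have p: "p \<ge> 0" "p2 \<ge> 0"
    using assms by (auto simp: p_def p2_def intro!: \<phi>'_nonneg V_bound \<phi>_V_bound)
  have "V x + \<phi> (V x) = spow (1 / \<alpha>) x"
    using G_V[OF assms] \<alpha> by (metis G_def spow_inverse(1) less_trans zero_less_one)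
  then have "\<bar>V x + \<phi> (V x)\<bar> = \<bar>x\<bar> powr (1 / \<alpha>)"
    using \<alpha> by (simp add: abs_spow)
  then have den: "G' (V x) = \<alpha> * \<bar>x\<bar> powr ((\<alpha> - 1) / \<alpha>) * (1 + p)"
    by (simp add: G'_def p_def powr_powr)
  have num: "G' (\<phi> (V x)) \<le> \<alpha> * (4 * \<bar>x\<bar>) powr (\<alpha> - 1) * (1 + p2)"
    unfolding G'_def p2_def[symmetric] using \<alpha> p abs_sum_\<phi>_V_le[OF assms]
    by (intro mult_right_mono mult_left_mono powr_mono2) auto
  have num0: "0 \<le> G' (\<phi> (V x))"
    unfolding G'_def p2_def[symmetric] using \<alpha> p by auto
  have "\<bar>\<gamma>' x\<bar> = G' (\<phi> (V x)) * p / (\<alpha> * \<bar>x\<bar> powr ((\<alpha> - 1) / \<alpha>) * (1 + p))"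
    using num0 p \<alpha> by (simp add: \<gamma>'_def den p_def[symmetric])
  \<comment> \<open>Replacing p by 1 + p lets the factor \<open>\<phi>' (V x)\<close> cancel against
    the same factor in the denominator.\<close>
  also have "\<dots> \<le> (\<alpha> * (4 * \<bar>x\<bar>) powr (\<alpha> - 1) * (1 + p2)) * (1 + p)
      / (\<alpha> * \<bar>x\<bar> powr ((\<alpha> - 1) / \<alpha>) * (1 + p))"
    using num num0 p \<alpha> by (intro divide_right_mono mult_mono) auto
  also have "\<dots> = 4 powr (\<alpha> - 1) * (1 + p2) * (\<bar>x\<bar> powr (\<alpha> - 1) / \<bar>x\<bar> powr ((\<alpha> - 1) / \<alpha>))"
    using \<alpha> p by (simp add: powr_mult)
  also have "\<bar>x\<bar> powr (\<alpha> - 1) / \<bar>x\<bar> powr ((\<alpha> - 1) / \<alpha>) = \<bar>x\<bar> powr (\<alpha> - 1 - (\<alpha> - 1) / \<alpha>)"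
    by (rule powr_diff[symmetric])
  also have "\<alpha> - 1 - (\<alpha> - 1) / \<alpha> = (\<alpha> - 1)\<^sup>2 / \<alpha>"
    using \<alpha> by (simp add: field_simps power2_eq_square)
  finally show ?thesis
    by (simp add: p2_def)
qed

lemma isCont_\<phi>_V: "\<bar>x\<bar> < \<delta> \<Longrightarrow> isCont (\<lambda>x. \<phi> (V x)) x"
  by (intro isCont_o2[OF isCont_V] isCont_\<phi> V_bound)

text \<open>Away from 0 the quotient has a nonzero denominator. At 0 the bound
  \<open>abs_\<gamma>'_le\<close> applies: its factor containing \<open>\<phi>'\<close> has a finite
  limit and its power of \<open>\<bar>x\<bar>\<close> tends to 0.\<close>

lemma isCont_\<gamma>':
  assumes "\<bar>x\<bar> < \<delta>"
  shows "isCont \<gamma>' x"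
proof (cases "x = 0")
  case False
  have "G' (V x) \<noteq> 0"
    using G'_pos[of "V x"] assms False by (simp add: V_bound G_V)
  then show ?thesis
    unfolding \<gamma>'_def[abs_def] using assms
    by (intro isCont_divide isCont_mult isCont_o2[OF isCont_V] isCont_o2[OF isCont_\<phi>_V]
        isCont_G' deriv_cont V_bound \<phi>_V_bound)
next
  case True
  have "isCont (\<lambda>x. \<phi>' (\<phi> (V x))) 0"
    using \<delta>_pos by (intro isCont_o2[OF isCont_\<phi>_V] deriv_cont \<phi>_V_bound) auto
  then have "((\<lambda>x. 4 powr (\<alpha> - 1) * (1 + \<phi>' (\<phi> (V x))) * \<bar>x\<bar> powr ((\<alpha> - 1)\<^sup>2 / \<alpha>)) \<longlongrightarrow> 0) (at 0)"
    unfolding isCont_def using \<alpha> by (auto intro!: tendsto_eq_intros)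
  moreover have "\<forall>\<^sub>F x in at 0. norm (\<gamma>' x)
      \<le> 4 powr (\<alpha> - 1) * (1 + \<phi>' (\<phi> (V x))) * \<bar>x\<bar> powr ((\<alpha> - 1)\<^sup>2 / \<alpha>)"
    using eventually_at_in_open'[of "{-\<delta><..<\<delta>}" 0] \<delta>_pos
    by (auto elim!: eventually_mono intro!: abs_\<gamma>'_le)
  ultimately have "(\<gamma>' \<longlongrightarrow> 0) (at 0)"
    by (rule Lim_null_comparison[rotated])
  then show ?thesis
    by (simp add: True isCont_def \<gamma>'_def V_0 \<phi>_0 G'_def)
qed

lemma C1_\<gamma>: "\<gamma> C1_differentiable_on {-\<delta><..<\<delta>}"
  unfolding C1_differentiable_on_def
  by (intro exI[of _ \<gamma>'])
     (auto simp: has_real_derivative_iff_has_vector_derivative[symmetric] abs_less_iff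
       intro!: \<gamma>_deriv continuous_at_imp_continuous_on isCont_\<gamma>')

text \<open>Both summands of \<open>\<phi> (\<phi> v) = G (\<phi> (\<phi> v)) + G (\<phi> v)\<close>, with \<open>v = V x\<close>, are at most \<open>\<bar>\<gamma> x\<bar>\<close>.\<close>

lemma \<gamma>_perturbation:
  assumes "\<bar>x\<bar> < \<delta>"
  defines "r \<equiv> \<gamma> x + \<phi> (\<phi> (V x))"
  shows "\<gamma> x = spow \<alpha> (x + r)" "\<bar>r\<bar> \<le> 3 * (4 * \<bar>x\<bar>) powr \<alpha>"
proof -
  let ?p = "\<phi> (V x)"
  have p: "\<bar>?p\<bar> < \<epsilon>" using assms(1) by (rule \<phi>_V_bound)
  have "\<gamma> x = spow \<alpha> (?p + \<phi> ?p)"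
    by (simp add: \<gamma>_def G_def)
  also have "?p + \<phi> ?p = x + r"
    using \<gamma>_eq[OF assms(1)] by (simp add: r_def)
  finally show "\<gamma> x = spow \<alpha> (x + r)" .
  have "\<bar>G (\<phi> ?p)\<bar> \<le> \<bar>\<gamma> x\<bar>"
    unfolding \<gamma>_def by (intro abs_G_mono p contracting)
  then have "\<bar>\<phi> ?p\<bar> \<le> 2 * \<bar>\<gamma> x\<bar>"
    using G_split[OF p] by (simp add: \<gamma>_def)
  \<comment> \<open>The factor 3 counts \<open>\<bar>\<gamma> x\<bar>\<close> once for the first
    term of r and twice for the second.\<close>
  then show "\<bar>r\<bar> \<le> 3 * (4 * \<bar>x\<bar>) powr \<alpha>"
    using abs_\<gamma>_le_powr[OF assms(1)] unfolding r_def by linarith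
qed

text \<open>Multiplicativity of the signed power turns \<open>spow \<alpha> (x + r x)\<close> into
  \<open>spow \<alpha> x * spow \<alpha> (1 + r x / x)\<close>. Since \<open>r x / x\<close> tends
  to 0, continuity of the power at 1 makes the second factor tend to 1.\<close>

lemma \<gamma>_asymptotics: "(\<lambda>x. \<gamma> x - spow \<alpha> x) \<in> o[at 0](\<lambda>x. \<bar>x\<bar> powr \<alpha>)"
proof (rule smalloI_tendsto)
  define r where "r x = \<gamma> x + \<phi> (\<phi> (V x))" for x
  note r = \<gamma>_perturbation[folded r_def]
  have near: "\<forall>\<^sub>F x in at 0. \<bar>x\<bar> < \<delta> \<and> x \<noteq> 0"
    using eventually_at_in_open[of "{-\<delta><..<\<delta>}" 0] \<delta>_pos by (auto elim!: eventually_mono)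
  have "((\<lambda>x. 3 * 4 powr \<alpha> * \<bar>x\<bar> powr (\<alpha> - 1)) \<longlongrightarrow> 0) (at (0::real))"
    using \<alpha> by (auto intro!: tendsto_eq_intros)
  moreover have "\<forall>\<^sub>F x in at 0. norm (r x / x) \<le> 3 * 4 powr \<alpha> * \<bar>x\<bar> powr (\<alpha> - 1)"
    using near by eventually_elim
      (use r(2) in \<open>auto simp: abs_divide powr_mult powr_diff field_simps\<close>)
  ultimately have "((\<lambda>x. r x / x) \<longlongrightarrow> 0) (at 0)"
    by (rule Lim_null_comparison[rotated])
  then have "((\<lambda>x. 1 + r x / x) \<longlongrightarrow> 1) (at 0)"
    using tendsto_add[OF tendsto_const[of "1::real"]] by fastforce
  then have "((\<lambda>x. spow \<alpha> (1 + r x / x)) \<longlongrightarrow> 1) (at 0)"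
    using isCont_tendsto_compose[OF isCont_spow[OF \<alpha>, of 1]] by simp
  then have "((\<lambda>x. \<bar>spow \<alpha> (1 + r x / x) - 1\<bar>) \<longlongrightarrow> 0) (at 0)"
    by (auto intro!: tendsto_eq_intros)
  moreover have "\<forall>\<^sub>F x in at 0. norm ((\<gamma> x - spow \<alpha> x) / \<bar>x\<bar> powr \<alpha>)
      \<le> \<bar>spow \<alpha> (1 + r x / x) - 1\<bar>"
    using near
  proof eventually_elim
    case (elim x)
    have "x + r x = x * (1 + r x / x)"
      using elim by (simp add: field_simps)
    then have "\<gamma> x = spow \<alpha> x * spow \<alpha> (1 + r x / x)"
      using elim r(1) by (metis spow_mult)
    then have "\<gamma> x - spow \<alpha> x = spow \<alpha> x * (spow \<alpha> (1 + r x / x) - 1)"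
      by (simp add: algebra_simps)
    then show ?case
      using elim \<alpha> by (simp add: abs_mult abs_spow)
  qed
  ultimately show "((\<lambda>x. (\<gamma> x - spow \<alpha> x) / \<bar>x\<bar> powr \<alpha>) \<longlongrightarrow> 0) (at 0)"
    by (rule Lim_null_comparison[rotated])
  show "\<forall>\<^sub>F x in at 0. \<bar>x\<bar> powr \<alpha> \<noteq> 0"
    using near by eventually_elim auto
qed

text \<open>The two descriptions differ by the change of parameter \<open>x = G u\<close>, with
  inverse \<open>u = V x\<close>.\<close>

lemma curve_eq_graph: "{(G u, G (\<phi> u)) | u. \<bar>u\<bar> < \<epsilon>} = {(x, \<gamma> x) | x. \<bar>x\<bar> < \<delta>}"
proof (intro subset_antisym subsetI)
  fix p assume "p \<in> {(G u, G (\<phi> u)) | u. \<bar>u\<bar> < \<epsilon>}"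
  then show "p \<in> {(x, \<gamma> x) | x. \<bar>x\<bar> < \<delta>}"
    by (auto simp: \<gamma>_def V_G intro!: abs_G_less_\<delta>)
next
  fix p assume "p \<in> {(x, \<gamma> x) | x. \<bar>x\<bar> < \<delta>}"
  then obtain x where "p = (x, \<gamma> x)" "\<bar>x\<bar> < \<delta>"
    by blast
  then have "p = (G (V x), G (\<phi> (V x)))" "\<bar>V x\<bar> < \<epsilon>"
    by (simp_all add: \<gamma>_def G_V V_bound)
  then show "p \<in> {(G u, G (\<phi> u)) | u. \<bar>u\<bar> < \<epsilon>}"
    by blast
qed

end

section \<open>Orbits of T and the four assertions\<close>

text \<open>The first components give one expression for \<open>w n\<close> as a sum of two powers.
  Inverting the power in the second components shows that the same sum equals
  \<open>u (Suc n)\<close>, so a planar orbit is a scalar solution of the stationary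
  equation.\<close>

lemma T_solution_h_map:
  assumes "\<alpha> > 0" "T_solution \<alpha> s" "\<And>n. s n = h_map \<alpha> (u n, w n)"
  shows "w n = u (Suc n)"
    and "u (Suc n) = spow \<alpha> (u n + u (Suc n)) + spow \<alpha> (u (Suc n) + u (Suc (Suc n)))"
proof -
  have *: "w n = u (Suc n) \<and> w n = spow \<alpha> (u n + w n) + spow \<alpha> (u (Suc n) + w (Suc n))" for n
  proof -
    have eq: "spow \<alpha> (u (Suc n) + w (Suc n)) = w n - spow \<alpha> (u n + w n)"
      "w (Suc n) - spow \<alpha> (u (Suc n) + w (Suc n))
        = spow (1 / \<alpha>) (w n - spow \<alpha> (u n + w n))
          - 2 * (w n - spow \<alpha> (u n + w n)) - spow \<alpha> (u n + w n)"
      using assms(2)[unfolded T_solution_def, rule_format, of n] assms(3)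
      by (simp_all add: h_map_def T_map_def q_map_def)
    have "spow (1 / \<alpha>) (w n - spow \<alpha> (u n + w n)) = u (Suc n) + w (Suc n)"
      using assms(1) by (simp add: eq(1)[symmetric] spow_inverse)
    with eq show ?thesis
      by (simp add: algebra_simps)
  qed
  have w: "w n = u (Suc n)" for n
    using * by blast
  then show "w n = u (Suc n)" .
  show "u (Suc n) = spow \<alpha> (u n + u (Suc n)) + spow \<alpha> (u (Suc n) + u (Suc (Suc n)))"
    using *[of n] unfolding w by blast
qed

theorem theorem4:
  fixes \<alpha> \<epsilon> R :: real and \<psi> :: "real \<Rightarrow> linf"
  assumes "\<alpha> > 1"
    and "local_solution_family \<alpha> \<epsilon> R \<psi>"
  shows "(T_map \<alpha> ` Ws_loc_tilde \<alpha> \<epsilon> \<psi> \<subseteq> Ws_loc_tilde \<alpha> \<epsilon> \<psi>) \<and>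
    (\<forall>s. T_solution \<alpha> s \<and> s 0 \<in> Ws_loc_tilde \<alpha> \<epsilon> \<psi> \<longrightarrow> s \<longlonglongrightarrow> (0, 0)) \<and>
    (\<forall>s. T_solution \<alpha> s \<and> (\<forall>n. s n \<in> Omega_tilde \<alpha> \<epsilon>)
        \<longrightarrow> (\<forall>n. s n \<in> Ws_loc_tilde \<alpha> \<epsilon> \<psi>)) \<and>
    (\<exists>\<epsilon>1>0. \<exists>\<gamma>::real \<Rightarrow> real.
        \<gamma> C1_differentiable_on {-\<epsilon>1<..<\<epsilon>1} \<and>
        Ws_loc_tilde \<alpha> \<epsilon> \<psi> = {(x, \<gamma> x) | x. \<bar>x\<bar> < \<epsilon>1} \<and>
        {(x, \<gamma> x) | x. \<bar>x\<bar> < \<epsilon>1} \<subseteq> Omega_tilde \<alpha> \<epsilon> \<and>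
        (\<forall>x\<in>{-\<epsilon>1<..<\<epsilon>1}. \<gamma> (- x) = - \<gamma> x) \<and>
        strict_mono_on {-\<epsilon>1<..<\<epsilon>1} \<gamma> \<and>
        (\<lambda>x. \<gamma> x - spow \<alpha> x) \<in> o[at 0](\<lambda>x. \<bar>x\<bar> powr \<alpha>))"
proof -
  define \<phi> where "\<phi> u = coord (\<psi> u) 1" for u
  have ball: "u \<in> {-\<epsilon><..<\<epsilon>} \<longleftrightarrow> \<bar>u\<bar> < \<epsilon>" for u
    by auto
  note fam = assms(2)[unfolded local_solution_family_def Let_def, folded \<phi>_def[abs_def] \<phi>_def,
      unfolded Ball_def Diff_iff ball]
  have \<epsilon>: "0 < \<epsilon>" and \<epsilon>_R: "\<epsilon> < R" and C1: "\<psi> C1_differentiable_on {-\<epsilon><..<\<epsilon>}"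
    using fam by blast+
  have odd: "\<psi> (- u) = - \<psi> u" if "\<bar>u\<bar> < \<epsilon>" for u
    using fam that by blast
  have unique: "u = \<psi> u0" if "\<bar>u0\<bar> < \<epsilon>" "norm u < R" "stationary_map \<alpha> u0 u = 0" for u0 u
    using fam that by auto
  have mono: "strict_mono_on {-\<epsilon><..<\<epsilon>} \<phi>"
    using fam by blast
  have contr: "\<bar>\<phi> u\<bar> < \<bar>u\<bar>" if "\<bar>u\<bar> < \<epsilon>" "u \<noteq> 0" for u
    using fam that by blast
  have iter: "coord (\<psi> u) k = (\<phi> ^^ k) u" if "\<bar>u\<bar> < \<epsilon>" "k \<ge> 1" for u k
    using fam that by blast
  have inv: "\<phi> u = spow \<alpha> (\<phi> u + \<phi> (\<phi> u)) + spow \<alpha> (u + \<phi> u)" if "\<bar>u\<bar> < \<epsilon>" for u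
    using fam that by blast
  have lim: "(\<lambda>k. coord (\<psi> u) k) \<longlonglongrightarrow> 0" if "\<bar>u\<bar> < \<epsilon>" for u
    using fam that by blast
  obtain D where D: "\<And>u. \<bar>u\<bar> < \<epsilon> \<Longrightarrow> (\<psi> has_vector_derivative D u) (at u)"
      "continuous_on {-\<epsilon><..<\<epsilon>} D"
    using C1 unfolding C1_differentiable_on_def ball[symmetric] by blast
  have \<phi>_odd: "\<phi> (- u) = - \<phi> u" if "\<bar>u\<bar> < \<epsilon>" for u
    using odd[OF that] by (simp add: \<phi>_def coord_def)
  interpret stable_curve \<alpha> \<epsilon> \<phi> "\<lambda>u. coord (D u) 1"
  proof
    fix u assume u: "\<bar>u\<bar> < \<epsilon>"
    show "\<bar>\<phi> u\<bar> \<le> \<bar>u\<bar>"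
      using contr[OF u] \<phi>_odd[of 0] \<epsilon> by (cases "u = 0") auto
    show "(\<phi> has_real_derivative coord (D u) 1) (at u)"
      unfolding \<phi>_def[abs_def] has_real_derivative_iff_has_vector_derivative
      by (rule bounded_linear.has_vector_derivative[OF bounded_linear_coord D(1)[OF u]])
    have "isCont D u"
      using D(2) u by (simp add: continuous_on_eq_continuous_at abs_less_iff)
    then show "isCont (\<lambda>u. coord (D u) 1) u"
      by (rule bounded_linear.isCont[OF bounded_linear_coord])
    show "\<phi> u = spow \<alpha> (\<phi> u + \<phi> (\<phi> u)) + spow \<alpha> (u + \<phi> u)"
      using u by (rule inv)
    show "\<phi> (- u) = - \<phi> u"
      using u by (rule \<phi>_odd)
  next
    show "1 < \<alpha>" by (rule assms(1))
    show "0 < \<epsilon>" by (rule \<epsilon>)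
    show "strict_mono_on {-\<epsilon><..<\<epsilon>} \<phi>" by (rule mono)
  qed
  have W: "Ws_loc_tilde \<alpha> \<epsilon> \<psi> = {(G u, G (\<phi> u)) | u. \<bar>u\<bar> < \<epsilon>}"
  proof -
    have "Ws_loc_tilde \<alpha> \<epsilon> \<psi> = {h_map \<alpha> (u, \<phi> u) | u. \<bar>u\<bar> < \<epsilon>}"
      unfolding Ws_loc_tilde_def Ws_loc_def \<phi>_def[symmetric] by blast
    also have "\<dots> = {(G u, G (\<phi> u)) | u. \<bar>u\<bar> < \<epsilon>}"
      using h_map_curve by metis
    finally show ?thesis .
  qed
  have curve_subset: "Ws_loc_tilde \<alpha> \<epsilon> \<psi> \<subseteq> Omega_tilde \<alpha> \<epsilon>"
    unfolding Ws_loc_tilde_def Omega_tilde_def Ws_loc_def Omega_def \<phi>_def[symmetric]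
  proof (intro image_mono subsetI)
    fix p assume "p \<in> {(u0, \<phi> u0) | u0. \<bar>u0\<bar> < \<epsilon>}"
    then obtain u where "p = (u, \<phi> u)" "\<bar>u\<bar> < \<epsilon>"
      by blast
    then show "p \<in> {-\<epsilon><..<\<epsilon>} \<times> {-\<epsilon><..<\<epsilon>}"
      using \<phi>_bound[of u] by (simp add: ball del: greaterThanLessThan_iff)
  qed
  have inv_W: "T_map \<alpha> p \<in> Ws_loc_tilde \<alpha> \<epsilon> \<psi>" if "p \<in> Ws_loc_tilde \<alpha> \<epsilon> \<psi>" for p
    using that T_map_curve \<phi>_bound unfolding W by blast
  have "s \<longlonglongrightarrow> (0, 0)" if s: "T_solution \<alpha> s" "s 0 \<in> Ws_loc_tilde \<alpha> \<epsilon> \<psi>" for s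
  proof -
    obtain u where u: "\<bar>u\<bar> < \<epsilon>" "s 0 = (G u, G (\<phi> u))"
      using s(2) unfolding W by blast
    have sn: "\<bar>(\<phi> ^^ n) u\<bar> < \<epsilon> \<and> s n = (G ((\<phi> ^^ n) u), G ((\<phi> ^^ Suc n) u))" for n
    proof (induction n)
      case (Suc n)
      then show ?case
        using s(1) T_map_curve[of "(\<phi> ^^ n) u"] \<phi>_bound[of "(\<phi> ^^ n) u"]
        by (simp add: T_solution_def)
    qed (simp add: u)
    \<comment> \<open>Coordinates are iterates of \<phi> only from index 1 on, which is enough for
      the limit.\<close>
    have "\<forall>\<^sub>F k in sequentially. coord (\<psi> u) k = (\<phi> ^^ k) u"
      using eventually_ge_at_top[of 1] by eventually_elim (use iter u in blast)
    then have "(\<lambda>n. (\<phi> ^^ n) u) \<longlonglongrightarrow> 0"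
      using lim[OF u(1)] by (rule Lim_transform_eventually[rotated])
    then have *: "(\<lambda>n. G ((\<phi> ^^ n) u)) \<longlonglongrightarrow> 0"
      using isCont_tendsto_compose[OF isCont_G[of 0]] \<epsilon> by (simp add: G_0)
    have "(\<lambda>n. (G ((\<phi> ^^ n) u), G ((\<phi> ^^ Suc n) u))) \<longlonglongrightarrow> (0, 0)"
      by (intro tendsto_Pair * LIMSEQ_Suc[OF *])
    then show ?thesis
      using sn by presburger
  qed
  moreover have "s n \<in> Ws_loc_tilde \<alpha> \<epsilon> \<psi>"
    if s: "T_solution \<alpha> s" "\<forall>n. s n \<in> Omega_tilde \<alpha> \<epsilon>" for s n
  \<comment> \<open>Uniqueness is used only for the initial point; positive invariance then
    propagates membership in the curve.\<close>
  proof (induction n)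
    case 0
    have "\<forall>n. \<exists>u w. s n = h_map \<alpha> (u, w) \<and> \<bar>u\<bar> < \<epsilon> \<and> \<bar>w\<bar> < \<epsilon>"
      using s(2) by (fastforce simp: Omega_tilde_def Omega_def)
    then obtain v w where v: "\<And>n. s n = h_map \<alpha> (v n, w n)" "\<And>n. \<bar>v n\<bar> < \<epsilon>"
      by metis
    note sol = T_solution_h_map[OF _ s(1) v(1)]
    obtain u where u: "\<And>n. n \<ge> 1 \<Longrightarrow> coord u n = v n" "norm u \<le> \<epsilon>"
      using ex_linf_coord[of v \<epsilon>] v(2) by (metis less_imp_le)
    then have "prepend (v 0) u n = v n" for n
      by (simp add: prepend_def)
    \<comment> \<open>The recursion at index n - 1 is the stationary equation at index n, with
      \<open>v 0\<close> as boundary value.\<close>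
    moreover have "v n = spow \<alpha> (v (n + 1) + v n) + spow \<alpha> (v n + v (n - 1))" if "n \<ge> 1" for n
      using sol(2)[of "n - 1"] that assms(1) by (simp add: add.commute)
    ultimately have "stationary_map \<alpha> (v 0) u = 0"
      using assms(1) by (simp add: stationary_map_eq_0_iff)
    \<comment> \<open>The supremum of the entries may reach \<epsilon>; the gap \<epsilon> < R keeps
      u inside the open ball where uniqueness holds.\<close>
    moreover have "norm u < R"
      using u(2) \<epsilon>_R by linarith
    ultimately have "u = \<psi> (v 0)"
      using v(2) by (intro unique)
    then have "w 0 = \<phi> (v 0)"
      using u(1)[of 1] sol(1)[of 0] assms(1) by (simp add: \<phi>_def)
    then show ?case
      using v(1)[of 0] v(2)[of 0] unfolding Ws_loc_tilde_def Ws_loc_def \<phi>_def[symmetric] by blast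
  next
    case (Suc n)
    then show ?case
      using inv_W s(1) unfolding T_solution_def by metis
  qed
  moreover have "\<forall>x\<in>{-\<delta><..<\<delta>}. \<gamma> (- x) = - \<gamma> x"
    by (auto intro!: \<gamma>_minus simp: abs_less_iff)
  moreover have W_graph: "Ws_loc_tilde \<alpha> \<epsilon> \<psi> = {(x, \<gamma> x) | x. \<bar>x\<bar> < \<delta>}"
    unfolding W by (rule curve_eq_graph)
  moreover note curve_subset[unfolded W_graph]
  moreover have "T_map \<alpha> ` Ws_loc_tilde \<alpha> \<epsilon> \<psi> \<subseteq> Ws_loc_tilde \<alpha> \<epsilon> \<psi>"
    using inv_W by blast
  ultimately show ?thesis
    using \<delta>_pos C1_\<gamma> strict_mono_\<gamma> \<gamma>_asymptotics by blast
qed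

end
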